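(* Let $n\ge 0$ be an integer. If $n$ is congruent to one of $2,3,170$ modulo $336$, then $E_n(1,x)$ is a permutation polynomial over $\mathbb{Z}_7$.
   Context: The $n$th reversed Dickson polynomial of the second kind (with parameter $1$) is the integer-coefficient polynomial $E_n(1,x)=\sum_{i=0}^{\lfloor n/2\rfloor}\binom{n-i}{i}(-x)^i$; equivalently $E_0(1,x)=1$, $E_1(1,x)=1$, $E_n(1,x)=E_{n-1}(1,x)-x\,E_{n-2}(1,x)$ for $n\ge 2$. A polynomial is a permutation polynomial over $\mathbb{Z}_7$ (the integers modulo $7$) if the map it induces $\mathbb{Z}_7\to\mathbb{Z}_7$ is a bijection. *)

theory Defs
  imports "HOL-Computational_Algebra.Polynomial" "HOL-Library.Numeral_Type"
begin

definition rev_dickson2 :: "nat \<Rightarrow> int poly" where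
  "rev_dickson2 n = (\<Sum>i = 0..n div 2. smult (int ((n - i) choose i)) ((- [:0, 1:]) ^ i))"

lemma rev_dickson2_extend:
  assumes "n div 2 \<le> N"
  shows "rev_dickson2 n = (\<Sum>i\<le>N. smult (int ((n - i) choose i)) ((- [:0, 1:]) ^ i))"
  unfolding rev_dickson2_def atLeast0AtMost
proof (rule sum.mono_neutral_left)
  show "\<forall>i\<in>{..N} - {..n div 2}. smult (int ((n - i) choose i)) ((- [:0, 1:]) ^ i) = 0"
  proof
    fix i assume "i \<in> {..N} - {..n div 2}"
    then have "n - i < i" by auto
    then show "smult (int ((n - i) choose i)) ((- [:0, 1:]) ^ i) = 0"
      by (simp add: binomial_eq_0)
  qed
qed (use assms in auto)

lemma rev_dickson2_0: "rev_dickson2 0 = 1"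
  and rev_dickson2_1: "rev_dickson2 (Suc 0) = 1"
  by (simp_all add: rev_dickson2_def)

lemma rev_dickson2_rec:
  "rev_dickson2 (Suc (Suc n)) = rev_dickson2 (Suc n) - [:0, 1:] * rev_dickson2 n"
proof -
  let ?y = "- [:0, 1:] :: int poly"
  have a: "rev_dickson2 n = (\<Sum>i\<le>n. smult (int ((n - i) choose i)) (?y ^ i))"
    by (rule rev_dickson2_extend) simp
  have b: "rev_dickson2 (Suc n) = 1 + (\<Sum>i\<le>n. smult (int ((n - i) choose Suc i)) (?y ^ Suc i))"
    by (subst rev_dickson2_extend[of _ "Suc n"]) (simp_all add: sum.atMost_Suc_shift del: sum.atMost_Suc power_Suc)
  have "rev_dickson2 (Suc (Suc n)) =
      1 + (\<Sum>i\<le>n. smult (int ((Suc n - i) choose Suc i)) (?y ^ Suc i))"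
    by (subst rev_dickson2_extend[of _ "Suc n"])
       (simp_all add: sum.atMost_Suc_shift del: sum.atMost_Suc power_Suc)
  also have "(\<Sum>i\<le>n. smult (int ((Suc n - i) choose Suc i)) (?y ^ Suc i)) =
      (\<Sum>i\<le>n. smult (int ((n - i) choose Suc i)) (?y ^ Suc i)
        + ?y * smult (int ((n - i) choose i)) (?y ^ i))"
    by (rule sum.cong) (auto simp: Suc_diff_le smult_add_left)
  also have "1 + \<dots> = rev_dickson2 (Suc n) + ?y * rev_dickson2 n"
    unfolding a b by (simp only: sum.distrib sum_distrib_left add.assoc)
  finally show ?thesis by simp
qed

text \<open>The ring of integers modulo 7 is the numeral type \<open>7\<close>; an integer polynomial is regarded
  as a polynomial over it via \<open>map_poly of_int\<close>.\<close>

definition permutation_poly :: "'a::comm_ring_1 poly \<Rightarrow> bool" where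
  "permutation_poly p \<longleftrightarrow> bij (poly p)"

end

theory Submission
  imports Defs "HOL-Combinatorics.Transposition"
begin

text \<open>
  For fixed \<open>x\<close> in the field of seven elements, the values \<open>E n x\<close> form a linear recurrence
  with shift operator \<open>S\<close> satisfying \<open>S\<^sup>2 = S - x\<close>, hence \<open>(2 S - 1)\<^sup>2 = d\<close> for the discriminant
  \<open>d = 1 - 4 x\<close>. Raising \<open>2 S - 1\<close> to the seventh power gives \<open>2 S\<^sup>7 - 1 = d\<^sup>3 (2 S - 1)\<close>, where
  \<open>d\<^sup>3\<close> is the quadratic character of \<open>d\<close>. This leaves three cases:

  \<^item> \<open>d\<close> a nonzero square, \<open>x = 0, 1, 5\<close>: \<open>S\<^sup>7 = S\<close>, and the values have period 6;
  \<^item> \<open>d = 0\<close>, \<open>x = 2\<close>: \<open>S\<^sup>7 = 1 / 2 = 4\<close>, and 4 has multiplicative order 3;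
  \<^item> \<open>d\<close> a nonsquare, \<open>x = 3, 4, 6\<close>: \<open>S\<^sup>7 = 1 - S\<close>, so \<open>S\<^sup>8 = S - S\<^sup>2 = x\<close>, and \<open>x\<^sup>6 = 1\<close>.

  These relations are the three lemmas \<open>E_shift_discr_square\<close>, \<open>E_shift_discr_zero\<close> and
  \<open>E_shift_discr_nonsquare\<close>; they are read off from the reduction of powers of \<open>S\<close> in \<open>E_add\<close>.
  In every case the values have period 336, so only \<open>n = 2, 3, 170\<close> matter. The first two give
  the bijections \<open>1 - x\<close> and \<open>1 - 2 x\<close>. Since \<open>170 \<equiv> 2\<close> modulo 6 and modulo 21, and
  \<open>170 = 8 \<sqdot> 21 + 2\<close>, the value of \<open>E 170\<close> at \<open>x\<close> is \<open>1 - x\<close> in the first two cases and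
  \<open>x\<^sup>2\<^sup>1 (1 - x) = x\<^sup>3 (1 - x)\<close> in the third. There \<open>x\<^sup>3\<close> is 1 at 4 and -1 at 3 and 6, and
  \<open>- (1 - 3) = 1 - 6\<close>: thus \<open>E 170\<close> is \<open>1 - x\<close> composed with the transposition of 3 and 6.
\<close>

definition E :: "nat \<Rightarrow> 7 \<Rightarrow> 7" where
  "E n x = poly (map_poly of_int (rev_dickson2 n)) x"

lemma map_poly_of_int_mult:
  "map_poly of_int (p * q) = (map_poly of_int p * map_poly of_int q :: 'a::comm_ring_1 poly)"
  by (rule poly_eqI) (simp add: coeff_map_poly coeff_mult)

lemma map_poly_of_int_diff:
  "map_poly of_int (p - q) = (map_poly of_int p - map_poly of_int q :: 'a::comm_ring_1 poly)"
  by (rule poly_eqI) (simp add: coeff_map_poly)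

lemma E_0: "E 0 x = 1" and E_1: "E (Suc 0) x = 1"
  by (simp_all add: E_def rev_dickson2_0 rev_dickson2_1)

lemma E_rec: "E (Suc (Suc n)) x = E (Suc n) x - x * E n x"
  by (simp add: E_def rev_dickson2_rec map_poly_of_int_diff map_poly_of_int_mult map_poly_pCons
      del: mult_pCons_left)

lemma E_2: "E 2 x = 1 - x" and E_3: "E 3 x = 1 - 2 * x"
  by (simp_all add: numeral_eq_Suc E_rec E_0 E_1)

text \<open>The arithmetic of the type decides \<open>iszero\<close> for numerals, so as a rewrite rule this removes
  coefficients divisible by 7 from terms with variables.\<close>

lemma Z7_numeral_eq_0: "iszero (numeral w :: 7) \<Longrightarrow> (numeral w :: 7) = 0"
  unfolding iszero_def .

text \<open>The cases are those of the discriminant \<open>1 - 4 x\<close>: a nonzero square, zero, a nonsquare.\<close>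

lemma Z7_cases:
  fixes x :: 7
  obtains "x \<in> {0, 1, 5}" | "x = 2" | "x \<in> {3, 4, 6}"
proof (cases x)
  case (of_int z)
  then have "z \<in> {0, 1, 2, 3, 4, 5, 6}" by auto
  then show thesis using of_int that by auto
qed

lemma E_at_0: "E n 0 = 1"
  by (induction n rule: induct_nat_012) (simp_all add: E_0 E_1 E_rec)

text \<open>This is the reduction \<open>S\<^sup>m\<^sup>+\<^sup>2 = E (m + 1) S - x E m\<close> modulo \<open>S\<^sup>2 - S + x\<close>, applied to the
  sequence at \<open>n\<close>. A power of \<open>S\<close> is therefore a scalar wherever the coefficient
  \<open>E (m + 1) x\<close> vanishes.\<close>

lemma E_add:
  "E (n + Suc (Suc m)) x = E (Suc m) x * E (Suc n) x - x * E m x * E n x"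
proof (induction m arbitrary: n)
  case (Suc m)
  from Suc.IH[of "Suc n"] show ?case
    by (simp add: E_rec algebra_simps)
qed (simp add: E_rec E_0 E_1)

lemma E_4: "E 4 x = 1 - 3 * x + x ^ 2"
  and E_5: "E 5 x = 1 - 4 * x + 3 * x ^ 2"
  and E_6: "E 6 x = 1 - 5 * x + 6 * x ^ 2 - x ^ 3"
  and E_7: "E 7 x = 1 - 6 * x + 10 * x ^ 2 - 4 * x ^ 3"
  by (simp_all add: numeral_eq_Suc E_rec E_0 E_1 algebra_simps)

text \<open>At \<open>x = 0\<close> the shift operator is not invertible, so \<open>S\<^sup>7 = S\<close> gives the period only
  from \<open>n = 1\<close> on; there the explicit constant value is used instead.\<close>

lemma E_shift_discr_square:
  assumes "x \<in> {0, 1, 5}"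
  shows "E (n + 6) x = E n x"
proof (cases "x = 0")
  case False
  with assms have "E 5 x = 0" "x * E 4 x = - 1"
    by (auto simp: E_4 E_5)
  with E_add[of n 4 x] show ?thesis by simp
qed (simp add: E_at_0)

lemma E_shift_discr_zero: "E (n + 7) 2 = 4 * E n 2"
proof -
  have "E 6 2 = 0" "2 * E 5 2 = - 4"
    by (simp_all add: E_5 E_6)
  with E_add[of n 5 2] show ?thesis by simp
qed

lemma E_shift_discr_nonsquare:
  assumes "x \<in> {3, 4, 6}"
  shows "E (n + 8) x = x * E n x"
proof -
  have "E 7 x = 0" "E 6 x = - 1"
    using assms by (auto simp: E_6 E_7)
  with E_add[of n 6 x] show ?thesis by simp
qed

lemma geometric_of_shift:
  fixes u :: "nat \<Rightarrow> 'a::comm_monoid_mult"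
  assumes "\<And>n. u (n + k) = c * u n"
  shows "u (k * m + r) = c ^ m * u r"
proof (induction m)
  case (Suc m)
  have "u (k * Suc m + r) = u ((k * m + r) + k)" by (simp add: algebra_simps)
  also have "\<dots> = c * u (k * m + r)" by (rule assms)
  finally show ?case by (simp add: Suc.IH mult.assoc)
qed simp

lemma E_discr_square:
  assumes "x \<in> {0, 1, 5}"
  shows "E (6 * m + r) x = E r x"
  using geometric_of_shift[of "\<lambda>n. E n x" 6 1 m r] E_shift_discr_square[OF assms] by simp

lemma E_discr_zero: "E (7 * m + r) 2 = 4 ^ m * E r 2"
  using geometric_of_shift[of "\<lambda>n. E n 2" 7 4 m r] E_shift_discr_zero by simp

lemma E_discr_nonsquare:
  assumes "x \<in> {3, 4, 6}"
  shows "E (8 * m + r) x = x ^ m * E r x"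
  using geometric_of_shift[of "\<lambda>n. E n x" 8 x m r] E_shift_discr_nonsquare[OF assms] by simp

lemma E_period: "E (336 * k + r) x = E r x"
proof (cases x rule: Z7_cases)
  case 1
  with E_discr_square[of x "56 * k" r] show ?thesis by simp
next
  case 2
  have "(4::7) ^ (48 * k) = (4 ^ 48) ^ k" by (rule power_mult)
  also have "(4::7) ^ 48 = 1" by simp
  finally show ?thesis using 2 E_discr_zero[of "48 * k" r] by simp
next
  case 3
  have "x ^ (42 * k) = (x ^ 42) ^ k" by (rule power_mult)
  also have "x ^ 42 = 1" using 3 by auto
  finally show ?thesis using E_discr_nonsquare[OF 3, of "42 * k" r] by simp
qed

text \<open>Only 3 and 6 deviate from \<open>E 2\<close>: they are the nonsquare-discriminant points with
  \<open>x\<^sup>2\<^sup>1 = -1\<close>, and \<open>- (1 - x)\<close> exchanges the values of \<open>1 - x\<close> at these two points.\<close>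

lemma E_170: "E 170 x = 1 - transpose 3 6 x"
proof (cases x rule: Z7_cases)
  case 1
  then have "transpose 3 6 x = x" by (auto intro: transpose_apply_other)
  with E_discr_square[OF 1, of 28 2] show ?thesis by (simp add: E_2)
next
  case 2
  have "transpose 3 6 (2::7) = 2" by (rule transpose_apply_other) simp_all
  with 2 E_discr_zero[of 24 2] show ?thesis by (simp add: E_2)
next
  case 3
  then have "x ^ 21 * (1 - x) = 1 - transpose 3 6 x" by (auto simp: transpose_def)
  with E_discr_nonsquare[OF 3, of 21 2] show ?thesis by (simp add: E_2)
qed

theorem theorem4p28:
  fixes n :: nat
  assumes "n mod 336 \<in> {2, 3, 170}"
  shows "permutation_poly (map_poly of_int (rev_dickson2 n) :: 7 poly)"
proof -
  have "E n x = E (n mod 336) x" for x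
    using E_period[of "n div 336" "n mod 336" x] by simp
  then have eq: "E n = E (n mod 336)" by (rule ext)
  have bij_2: "bij (\<lambda>x::7. 1 - x)"
    by (rule involuntory_imp_bij) simp
  have "bij (E n)"
    using assms unfolding eq
  proof (elim insertE emptyE; simp only:)
    show "bij (E 2)"
      using bij_2 by (simp add: E_2[abs_def])
    \<comment> \<open>4 is the inverse of 2 modulo 7.\<close>
    show "bij (E 3)"
      by (rule o_bij[of "\<lambda>y. 4 * (1 - y)"])
        (simp_all add: fun_eq_iff E_3 algebra_simps Z7_numeral_eq_0)
    have "E 170 = (\<lambda>x. 1 - x) \<circ> transpose 3 6"
      by (simp add: fun_eq_iff E_170)
    with bij_2 show "bij (E 170)"
      by (simp add: bij_comp)
  qed
  moreover have "E n = poly (map_poly of_int (rev_dickson2 n))"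
    by (rule ext) (rule E_def)
  ultimately show ?thesis
    unfolding permutation_poly_def by simp
qed

end
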